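(* Let $\mathcal{X}\in\mathbb{R}^{J_1\times\cdots\times J_N}$, fix a mode $n\in\{1,\dots,N\}$, put $p=\prod_{i\ne n}J_i$, let $X_{(n)}\in\mathbb{R}^{J_n\times p}$ be the mode-$n$ unfolding of $\mathcal{X}$, and let $R_n\le J_n$ and $k_n\le p$ be positive integers. For a threshold $\eta$ consider the problem $$(Q_\eta)\qquad \underset{\mathbf{s}\in\{0,1\}^{p}}{\text{maximize}}\quad \sum_{j=1}^{p}s_j\left\|X_{(n)}(:,j)\right\|_F^2$$ $$\text{subject to}\quad \mathbf{e}^\top\mathbf{s}\le k_n,\qquad \forall\,\sigma\subset[p]:\ \ \eta(\mathbf{s}^{\sigma})>\eta\ \Rightarrow\ \sum_{j\in\sigma}s_j\le|\sigma|-1.$$ Let $(\mathbf{s}^0,U_n[\mathbf{s}^0])$ be an optimal solution to $(Q_\eta)$ for a given threshold $\eta$ (that is, $\mathbf{s}^0$ is optimal and $U_n[\mathbf{s}^0]$ is its associated basis). Let $$V^*\in\underset{V\in\mathbb{R}^{J_n\times R_n},\;V^\top V=I_{R_n}}{\arg\min}\ \left\|X_{(n)}-VV^\top X_{(n)}\right\|_F$$ be a classical PCA solution, and define the residual matrix $\epsilon^n=X_{(n)}-V^*V^{*\top}X_{(n)}$. Let $\sigma^n\subset[p]$ be the set of indices of the $k_n$ columns of $\epsilon^n$ with the highest norm. Then $$\eta(\mathbf{s}^0)\le\left\|\epsilon^nS^0\right\|_F^2\le\sum_{i\in\sigma^n}\left\|\epsilon^n_i\right\|_F^2,$$ where $\epsilon^n_i$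 is the $i$-th column of $\epsilon^n$ and $S^0=\operatorname{diag}(\mathbf{s}^0)\in\mathbb{R}^{p\times p}$. Moreover, $\mathbf{s}^0$ is feasible for problem $(Q_{\eta'})$ with $\eta'=\|\epsilon^nS^0\|_F^2$.
   Context: The mode-$n$ unfolding $X_{(n)}$ of $\mathcal{X}$ is the $J_n\times\prod_{i\ne n}J_i$ matrix whose columns are the mode-$n$ fibers of $\mathcal{X}$. $[p]=\{1,\dots,p\}$; $\mathbf{e}\in\mathbb{R}^p$ is the all-ones vector; $\|\cdot\|_F$ is the Frobenius norm. $X_{(n)}(:,j)$ is the $j$-th column of $X_{(n)}$, and for $\mathbf{s}\in\{0,1\}^p$, $X_{(n)}(:,\mathbf{s})$ is the submatrix formed by the columns $j$ with $s_j=1$. For $\sigma\subset[p]$, $\mathbf{s}^\sigma\in\{0,1\}^p$ is the indicator vector of $\sigma$. For $\mathbf{s}\in\{0,1\}^p$, $U_n[\mathbf{s}]$ denotes a maximizer of $\operatorname{tr}\left(U^\top X_{(n)}(:,\mathbf{s})X_{(n)}(:,\mathbf{s})^\top U\right)$ over $U\in\mathbb{R}^{J_n\times R_n}$ with $U^\top U=I_{R_n}$, and $$\eta(\mathbf{s})=\left\|X_{(n)}(:,\mathbf{s})-U_n[\mathbf{s}]\,U_n[\mathbf{s}]^\top X_{(n)}(:,\mathbf{s})\right\|_F^2$$ (this value does not depend on the choice of maximizer). For the empty selection, $\eta(\mathbf{0})=0$. *)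

theory Defs
  imports Complex_Main "Jordan_Normal_Form.DL_Submatrix"
begin

text \<open>
  Conventions. A tensor in the space of format J 1 x ... x J N is a function on multi-indices
  m :: nat \<Rightarrow> nat with m i < J i for every mode i in {1..N}. Modes are numbered from 1, while the
  positions inside a mode and the rows and columns of a matrix are numbered from 0, so that the
  set [p] becomes {..<p}.
\<close>

definition multi_indices :: "nat set \<Rightarrow> (nat \<Rightarrow> nat) \<Rightarrow> (nat \<Rightarrow> nat) set" where
  "multi_indices M J = (\<Pi>\<^sub>E i\<in>M. {..<J i})"

text \<open>
  The order in which the mode-n fibers are arranged as columns is a parameter c, an enumeration
  of the multi-indices of the modes other than n; column j is the fiber at c j.
\<close>

definition fiber_order :: "nat \<Rightarrow> (nat \<Rightarrow> nat) \<Rightarrow> nat \<Rightarrow> (nat \<Rightarrow> nat \<Rightarrow> nat) \<Rightarrow> bool" where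
  "fiber_order N J n c \<longleftrightarrow>
     bij_betw c {..<\<Prod>i\<in>{1..N} - {n}. J i} (multi_indices ({1..N} - {n}) J)"

definition unfolding_mat ::
  "nat \<Rightarrow> (nat \<Rightarrow> nat) \<Rightarrow> nat \<Rightarrow> (nat \<Rightarrow> nat \<Rightarrow> nat) \<Rightarrow> ((nat \<Rightarrow> nat) \<Rightarrow> real) \<Rightarrow> real mat" where
  "unfolding_mat N J n c T =
     mat (J n) (\<Prod>i\<in>{1..N} - {n}. J i) (\<lambda>(i, j). T ((c j)(n := i)))"

definition mat_trace :: "real mat \<Rightarrow> real" where
  "mat_trace A = (\<Sum>i<dim_row A. A $$ (i, i))"

definition frob_norm :: "real mat \<Rightarrow> real" where
  "frob_norm A = sqrt (\<Sum>i<dim_row A. \<Sum>j<dim_col A. (A $$ (i, j))\<^sup>2)"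

definition binary_vecs :: "nat \<Rightarrow> real vec set" where
  "binary_vecs p = {s \<in> carrier_vec p. \<forall>j<p. s $ j \<in> {0, 1}}"

definition indicator_vec :: "nat \<Rightarrow> nat set \<Rightarrow> real vec" where
  "indicator_vec p \<sigma> = vec p (\<lambda>j. if j \<in> \<sigma> then 1 else 0)"

definition column :: "real mat \<Rightarrow> nat \<Rightarrow> real mat" where
  "column X j = submatrix X UNIV {j}"

definition selected_columns :: "real mat \<Rightarrow> real vec \<Rightarrow> real mat" where
  "selected_columns X s = submatrix X UNIV {j. j < dim_vec s \<and> s $ j = 1}"

definition orthonormal_frames :: "nat \<Rightarrow> nat \<Rightarrow> real mat set" where
  "orthonormal_frames m r = {U \<in> carrier_mat m r. U\<^sup>T * U = 1\<^sub>m r}"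

definition projection_residual :: "real mat \<Rightarrow> real mat \<Rightarrow> real mat" where
  "projection_residual V Y = Y - V * V\<^sup>T * Y"

text \<open>
  A choice U of one maximizer U s for every binary vector s; maximizers are not unique, and
  everything below is relative to such a choice.
\<close>

definition basis_choice :: "real mat \<Rightarrow> nat \<Rightarrow> (real vec \<Rightarrow> real mat) \<Rightarrow> bool" where
  "basis_choice X r U \<longleftrightarrow>
     (\<forall>s \<in> binary_vecs (dim_col X).
        is_arg_max
          (\<lambda>W. mat_trace (W\<^sup>T * selected_columns X s * (selected_columns X s)\<^sup>T * W))
          (\<lambda>W. W \<in> orthonormal_frames (dim_row X) r)
          (U s))"

definition eta :: "real mat \<Rightarrow> (real vec \<Rightarrow> real mat) \<Rightarrow> real vec \<Rightarrow> real" where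
  "eta X U s = (frob_norm (projection_residual (U s) (selected_columns X s)))\<^sup>2"

lemma eta_empty_selection: "eta X U (0\<^sub>v p) = 0"
proof -
  have no_index: "{j. j < dim_vec (0\<^sub>v p :: real vec) \<and> 0\<^sub>v p $ j = (1::real)} = {}"
    by auto
  have "dim_col (selected_columns X (0\<^sub>v p)) = 0"
    unfolding selected_columns_def no_index dim_submatrix by simp
  then show ?thesis
    by (simp add: eta_def frob_norm_def projection_residual_def)
qed

definition Q_feasible ::
  "real mat \<Rightarrow> nat \<Rightarrow> (real vec \<Rightarrow> real mat) \<Rightarrow> real \<Rightarrow> real vec \<Rightarrow> bool" where
  "Q_feasible X k U h s \<longleftrightarrow>
     s \<in> binary_vecs (dim_col X) \<and>
     vec (dim_col X) (\<lambda>_. 1) \<bullet> s \<le> real k \<and>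
     (\<forall>\<sigma> \<subseteq> {..<dim_col X}. eta X U (indicator_vec (dim_col X) \<sigma>) > h \<longrightarrow>
        (\<Sum>j\<in>\<sigma>. s $ j) \<le> real (card \<sigma>) - 1)"

definition Q_objective :: "real mat \<Rightarrow> real vec \<Rightarrow> real" where
  "Q_objective X s = (\<Sum>j<dim_col X. s $ j * (frob_norm (column X j))\<^sup>2)"

definition Q_optimal ::
  "real mat \<Rightarrow> nat \<Rightarrow> (real vec \<Rightarrow> real mat) \<Rightarrow> real \<Rightarrow> real vec \<Rightarrow> bool" where
  "Q_optimal X k U h s \<longleftrightarrow> is_arg_max (Q_objective X) (Q_feasible X k U h) s"

definition pca_solution :: "real mat \<Rightarrow> nat \<Rightarrow> real mat \<Rightarrow> bool" where
  "pca_solution X r V \<longleftrightarrow>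
     is_arg_min (\<lambda>W. frob_norm (projection_residual W X))
       (\<lambda>W. W \<in> orthonormal_frames (dim_row X) r) V"

text \<open>In case of ties there are several such sets.\<close>

definition top_columns :: "real mat \<Rightarrow> nat \<Rightarrow> nat set \<Rightarrow> bool" where
  "top_columns E k \<sigma> \<longleftrightarrow>
     \<sigma> \<subseteq> {..<dim_col E} \<and> card \<sigma> = k \<and>
     (\<forall>i\<in>\<sigma>. \<forall>j\<in>{..<dim_col E} - \<sigma>. frob_norm (column E j) \<le> frob_norm (column E i))"

end

theory Submission
  imports Defs
begin

text \<open>
  Two facts about orthonormal frames carry the proof.

  \<^item> By Pythagoras (\<open>frob_norm_sq_projection_residual\<close>), the energy of the projection residual
    of \<open>Y\<close> is the total energy of \<open>Y\<close> minus the trace that a basis of a selection maximizes.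
    Hence that basis minimizes the residual of its own selection, and any competing frame, in
    particular the classical PCA frame \<open>V\<close>, gives an upper bound for \<open>\<eta>(s)\<close>.
  \<^item> A projection acts on each column separately, so the residual of a selection under \<open>V\<close> is the
    corresponding selection of columns of the full residual \<open>E\<close>.

  Together they give \<open>\<eta>(s) \<le> \<Sum>\<^sub>j \<parallel>E\<^sub>j\<parallel>\<^sup>2\<close>, the sum being over the columns selected by \<open>s\<close>
  (\<open>eta_le_sum_residual_columns\<close>). The right-hand side only grows with the selection and equals
  \<open>\<parallel>E S\<parallel>\<^sup>2\<close> for \<open>S = diag s\<close>. The first inequality is the case \<open>s = s0\<close>. Feasibility follows
  from monotonicity: a set \<open>\<sigma>\<close> contained in the selection \<open>s0\<close> has \<open>\<eta>\<close> at most \<open>\<parallel>E S0\<parallel>\<^sup>2\<close>, so a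
  set above this threshold has an element that \<open>s0\<close> does not select. The second inequality is an
  exchange argument (\<open>sum_le_sum_top_set\<close>), as \<open>s0\<close> selects at most \<open>k\<close> columns.
\<close>

section \<open>Frobenius norm and column selections\<close>

lemma frob_norm_nonneg: "0 \<le> frob_norm A"
  by (simp add: frob_norm_def sum_nonneg)

lemma frob_norm_sq: "(frob_norm A)\<^sup>2 = (\<Sum>i<dim_row A. \<Sum>j<dim_col A. (A $$ (i, j))\<^sup>2)"
  by (simp add: frob_norm_def sum_nonneg)

lemma frob_norm_sq_trace: "(frob_norm A)\<^sup>2 = mat_trace (A\<^sup>T * A)"
  unfolding frob_norm_sq mat_trace_def
  by (subst sum.swap) (simp add: scalar_prod_def power2_eq_square lessThan_atLeast0)

lemma frob_norm_transpose: "frob_norm A\<^sup>T = frob_norm A"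
  unfolding frob_norm_def by (subst sum.swap) simp

lemma dim_column_submatrix:
  assumes "I \<subseteq> {..<dim_col A}"
  shows "dim_row (submatrix A UNIV I) = dim_row A" "dim_col (submatrix A UNIV I) = card I"
proof -
  have "{j. j < dim_col A \<and> j \<in> I} = I" using assms by auto
  then show "dim_row (submatrix A UNIV I) = dim_row A" "dim_col (submatrix A UNIV I) = card I"
    by (simp_all add: dim_submatrix)
qed

lemma pick_less_dim_col:
  assumes "I \<subseteq> {..<dim_col A}" "j < card I"
  shows "pick I j < dim_col A"
  using pick_in_set assms by (metis lessThan_iff subsetD)

lemma column_submatrix_index:
  assumes "I \<subseteq> {..<dim_col A}" "i < dim_row A" "j < card I"
  shows "submatrix A UNIV I $$ (i, j) = A $$ (i, pick I j)"
proof -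
  have "{j. j < dim_col A \<and> j \<in> I} = I" using assms(1) by auto
  then show ?thesis using submatrix_index[of i A UNIV j I] assms by (simp add: pick_UNIV)
qed

lemma frob_norm_sq_column:
  assumes "j < dim_col A"
  shows "(frob_norm (column A j))\<^sup>2 = (\<Sum>i<dim_row A. (A $$ (i, j))\<^sup>2)"
proof -
  have I: "{j} \<subseteq> {..<dim_col A}" using assms by simp
  have "pick {j} 0 = j" by (simp add: Least_equality)
  then have "submatrix A UNIV {j} $$ (i, 0) = A $$ (i, j)" if "i < dim_row A" for i
    using column_submatrix_index[OF I that, of 0] by simp
  then show ?thesis
    by (simp add: frob_norm_sq column_def dim_column_submatrix[OF I])
qed

lemma bij_betw_pick:
  assumes "finite I"
  shows "bij_betw (pick I) {..<card I} I"
proof -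
  have inj: "inj_on (pick I) {..<card I}"
    by (auto simp: inj_on_def) (metis pick_mono_inf pick_mono nat_neq_iff assms)
  moreover have "pick I ` {..<card I} \<subseteq> I" using pick_in_set assms by auto
  ultimately show ?thesis
    by (metis assms bij_betw_def card_image card_lessThan card_subset_eq)
qed

lemma frob_norm_sq_column_submatrix:
  assumes I: "I \<subseteq> {..<dim_col A}"
  shows "(frob_norm (submatrix A UNIV I))\<^sup>2 = (\<Sum>j\<in>I. (frob_norm (column A j))\<^sup>2)"
proof -
  have fin: "finite I" using I finite_subset by blast
  have "(frob_norm (submatrix A UNIV I))\<^sup>2 = (\<Sum>j<card I. (frob_norm (column A (pick I j)))\<^sup>2)"
    unfolding frob_norm_sq[of "submatrix A UNIV I"]
    by (subst sum.swap) (simp add: dim_column_submatrix[OF I] column_submatrix_index[OF I]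
        pick_less_dim_col[OF I] frob_norm_sq_column)
  also have "\<dots> = (\<Sum>j\<in>I. (frob_norm (column A j))\<^sup>2)"
    by (rule sum.reindex_bij_betw[OF bij_betw_pick[OF fin]])
  finally show ?thesis .
qed

lemma frob_norm_sq_mult_diag:
  assumes E: "E \<in> carrier_mat m p" and s: "s \<in> binary_vecs p"
  shows "(frob_norm (E * mat_diag p (\<lambda>j. s $ j)))\<^sup>2
    = (\<Sum>j | j < p \<and> s $ j = 1. (frob_norm (column E j))\<^sup>2)"
proof -
  have bin: "s $ j = 0 \<or> s $ j = 1" if "j < p" for j
    using s that by (auto simp: binary_vecs_def)
  have "(frob_norm (E * mat_diag p (\<lambda>j. s $ j)))\<^sup>2 = (\<Sum>i<m. \<Sum>j<p. (E $$ (i, j) * s $ j)\<^sup>2)"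
    by (simp add: frob_norm_sq mat_diag_mult_right[OF E])
  also have "\<dots> = (\<Sum>j<p. \<Sum>i<m. (E $$ (i, j) * s $ j)\<^sup>2)"
    by (rule sum.swap)
  also have "\<dots> = (\<Sum>j<p. if s $ j = 1 then (frob_norm (column E j))\<^sup>2 else 0)"
  proof (rule sum.cong[OF refl])
    fix j assume "j \<in> {..<p}"
    then show "(\<Sum>i<m. (E $$ (i, j) * s $ j)\<^sup>2)
        = (if s $ j = 1 then (frob_norm (column E j))\<^sup>2 else 0)"
      using bin[of j] E by (auto simp: frob_norm_sq_column)
  qed
  also have "\<dots> = (\<Sum>j | j < p \<and> s $ j = 1. (frob_norm (column E j))\<^sup>2)"
    by (simp add: sum.If_cases Int_def)
  finally show ?thesis .
qed

section \<open>Residuals of orthogonal projections\<close>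

lemma projection_residual_column_submatrix:
  assumes V: "V \<in> carrier_mat (dim_row X) r" and I: "I \<subseteq> {..<dim_col X}"
  shows "projection_residual V (submatrix X UNIV I) = submatrix (projection_residual V X) UNIV I"
proof -
  have I': "I \<subseteq> {..<dim_col (projection_residual V X)}"
    using I by (simp add: projection_residual_def)
  have col: "col (submatrix X UNIV I) j = col X (pick I j)" if "j < card I" for j
    by (rule eq_vecI) (use that in \<open>auto simp: dim_column_submatrix[OF I]
      column_submatrix_index[OF I] pick_less_dim_col[OF I]\<close>)
  have dims: "dim_row (projection_residual V Y) = dim_row V"
    "dim_col (projection_residual V Y) = dim_col Y" for Y
    by (simp_all add: projection_residual_def)
  show ?thesis
  proof (rule eq_matI)
    fix i j
    assume "i < dim_row (submatrix (projection_residual V X) UNIV I)"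
      and "j < dim_col (submatrix (projection_residual V X) UNIV I)"
    then have ij: "i < dim_row X" "j < card I"
      using V by (auto simp: dim_column_submatrix[OF I'] dims)
    then have "submatrix (projection_residual V X) UNIV I $$ (i, j)
        = projection_residual V X $$ (i, pick I j)"
      using V by (intro column_submatrix_index[OF I']) (auto simp: dims)
    also have "\<dots> = projection_residual V (submatrix X UNIV I) $$ (i, j)"
      using ij V by (simp add: projection_residual_def dim_column_submatrix[OF I] col
          column_submatrix_index[OF I] pick_less_dim_col[OF I])
    finally show "projection_residual V (submatrix X UNIV I) $$ (i, j)
        = submatrix (projection_residual V X) UNIV I $$ (i, j)" ..
  qed (use V in \<open>simp_all add: dims dim_column_submatrix[OF I] dim_column_submatrix[OF I']\<close>)
qed

text \<open>
  Pythagoras: \<open>V V\<^sup>T Y\<close> and \<open>Y - V V\<^sup>T Y\<close> are orthogonal, and the energy of the former is that of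
  \<open>V\<^sup>T Y\<close>, which is the trace on the right.
\<close>

lemma frob_norm_sq_projection_residual:
  assumes V: "V \<in> orthonormal_frames m r" and Y: "Y \<in> carrier_mat m q"
  shows "(frob_norm (projection_residual V Y))\<^sup>2 = (frob_norm Y)\<^sup>2 - mat_trace (V\<^sup>T * Y * Y\<^sup>T * V)"
proof -
  have Vc: "V \<in> carrier_mat m r" and VV: "V\<^sup>T * V = 1\<^sub>m r"
    using V by (auto simp: orthonormal_frames_def)
  define Z where "Z = V\<^sup>T * Y"
  have Zc: "Z \<in> carrier_mat r q" using Vc Y by (simp add: Z_def)
  have VZ: "V * Z \<in> carrier_mat m q" using Vc Zc by simp
  have ZT: "Z\<^sup>T = Y\<^sup>T * V"
    using transpose_mult[of "V\<^sup>T" r m Y q] Vc Y by (simp add: Z_def)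
  have VZT: "(V * Z)\<^sup>T = Z\<^sup>T * V\<^sup>T"
    by (rule transpose_mult[OF Vc Zc])
  have res: "projection_residual V Y = Y - V * Z"
    using Vc Y by (simp add: projection_residual_def Z_def assoc_mult_mat[of V m r "V\<^sup>T" m Y q])
  have ZZ: "Z\<^sup>T * Z \<in> carrier_mat q q" using Zc by simp
  have a: "Y\<^sup>T * (V * Z) = Z\<^sup>T * Z"
    using assoc_mult_mat[of "Y\<^sup>T" q m V r Z q] Vc Y Zc by (simp add: ZT)
  have b: "(V * Z)\<^sup>T * Y = Z\<^sup>T * Z"
    unfolding VZT using assoc_mult_mat[of "Z\<^sup>T" q r "V\<^sup>T" m Y q] Vc Y Zc by (simp add: Z_def)
  have "(V * Z)\<^sup>T * (V * Z) = Z\<^sup>T * (V\<^sup>T * (V * Z))"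
    unfolding VZT by (rule assoc_mult_mat[OF _ _ VZ]) (use Vc Zc in auto)
  also have "V\<^sup>T * (V * Z) = Z"
    using assoc_mult_mat[of "V\<^sup>T" r m V r Z q] Vc Zc by (simp add: VV)
  finally have d: "(V * Z)\<^sup>T * (V * Z) = Z\<^sup>T * Z" .
  have "(Y - V * Z)\<^sup>T * (Y - V * Z) = (Y\<^sup>T - (V * Z)\<^sup>T) * (Y - V * Z)"
    using transpose_minus[OF Y VZ] by simp
  also have "\<dots> = Y\<^sup>T * (Y - V * Z) - (V * Z)\<^sup>T * (Y - V * Z)"
    by (rule minus_mult_distrib_mat[OF _ _ minus_carrier_mat[OF VZ]]) (use Y VZ in simp_all)
  also have "Y\<^sup>T * (Y - V * Z) = Y\<^sup>T * Y - Z\<^sup>T * Z"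
    using mult_minus_distrib_mat[of "Y\<^sup>T" q m Y q "V * Z"] Y VZ by (simp add: a)
  also have "(V * Z)\<^sup>T * (Y - V * Z) = Z\<^sup>T * Z - Z\<^sup>T * Z"
    using mult_minus_distrib_mat[of "(V * Z)\<^sup>T" q m Y q "V * Z"] Y VZ by (simp add: b d)
  finally have gram: "(Y - V * Z)\<^sup>T * (Y - V * Z) = Y\<^sup>T * Y - Z\<^sup>T * Z - (Z\<^sup>T * Z - Z\<^sup>T * Z)" .
  have "(frob_norm (projection_residual V Y))\<^sup>2 = mat_trace (Y\<^sup>T * Y) - mat_trace (Z\<^sup>T * Z)"
    unfolding res frob_norm_sq_trace gram mat_trace_def
    using Y Zc by (simp add: sum_subtractf)
  also have "\<dots> = (frob_norm Y)\<^sup>2 - (frob_norm Z)\<^sup>2"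
    by (simp only: frob_norm_sq_trace)
  also have "(frob_norm Z)\<^sup>2 = mat_trace (Z * Z\<^sup>T)"
    using frob_norm_sq_trace[of "Z\<^sup>T"] by (simp add: frob_norm_transpose)
  also have "Z * Z\<^sup>T = V\<^sup>T * Y * Y\<^sup>T * V"
    unfolding ZT unfolding Z_def
    using assoc_mult_mat[of "V\<^sup>T * Y" r q "Y\<^sup>T" m V r] Vc Y by simp
  finally show ?thesis .
qed

text \<open>
  By Pythagoras, maximizing the projected energy of a selection is minimizing its residual, so
  the chosen basis does at least as well on the selection as any fixed frame \<open>V\<close>.
\<close>

lemma eta_le_sum_residual_columns:
  assumes U: "basis_choice X r U" and s: "s \<in> binary_vecs (dim_col X)"
    and V: "V \<in> orthonormal_frames (dim_row X) r"
  shows "eta X U s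
    \<le> (\<Sum>j | j < dim_col X \<and> s $ j = 1. (frob_norm (column (projection_residual V X) j))\<^sup>2)"
proof -
  define I where "I = {j. j < dim_col X \<and> s $ j = 1}"
  have I: "I \<subseteq> {..<dim_col X}" by (auto simp: I_def)
  have sel: "selected_columns X s = submatrix X UNIV I"
    using s by (auto simp: selected_columns_def I_def binary_vecs_def)
  define Y where "Y = submatrix X UNIV I"
  have Y: "Y \<in> carrier_mat (dim_row X) (card I)"
    by (auto simp: Y_def dim_column_submatrix[OF I])
  have Us: "U s \<in> orthonormal_frames (dim_row X) r"
    and le: "mat_trace (V\<^sup>T * Y * Y\<^sup>T * V) \<le> mat_trace ((U s)\<^sup>T * Y * Y\<^sup>T * U s)"
    using U s V unfolding basis_choice_def is_arg_max_def Y_def sel[symmetric]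
    by (auto simp: not_less)
  have "eta X U s = (frob_norm (projection_residual (U s) Y))\<^sup>2"
    by (simp add: eta_def sel Y_def)
  also have "\<dots> \<le> (frob_norm (projection_residual V Y))\<^sup>2"
    using le by (simp add: frob_norm_sq_projection_residual[OF Us Y]
        frob_norm_sq_projection_residual[OF V Y])
  also have "\<dots> = (frob_norm (submatrix (projection_residual V X) UNIV I))\<^sup>2"
    using V projection_residual_column_submatrix[OF _ I, of V r]
    by (simp add: Y_def orthonormal_frames_def)
  also have "\<dots> = (\<Sum>j\<in>I. (frob_norm (column (projection_residual V X) j))\<^sup>2)"
    using I by (intro frob_norm_sq_column_submatrix) (simp add: projection_residual_def)
  finally show ?thesis by (simp add: I_def)
qed

section \<open>Sums over a top set\<close>

text \<open>
  Exchange argument: the elements of \<open>\<tau>\<close> outside \<open>\<sigma>\<close> inject into those of \<open>\<sigma>\<close> outside \<open>\<tau>\<close>, and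
  each is replaced by one of at least the same weight.
\<close>

lemma sum_le_sum_top_set:
  fixes f :: "'a \<Rightarrow> real"
  assumes fin: "finite A" and sub: "\<tau> \<subseteq> A" "\<sigma> \<subseteq> A" and card: "card \<tau> \<le> card \<sigma>"
    and top: "\<And>i j. i \<in> \<sigma> \<Longrightarrow> j \<in> A - \<sigma> \<Longrightarrow> f j \<le> f i"
    and nonneg: "\<And>i. i \<in> \<sigma> \<Longrightarrow> 0 \<le> f i"
  shows "sum f \<tau> \<le> sum f \<sigma>"
proof -
  have fins: "finite \<tau>" "finite \<sigma>" using fin sub finite_subset by blast+
  have "card (\<tau> - \<sigma>) \<le> card (\<sigma> - \<tau>)"
    using card fins card_Diff_subset_Int[of \<tau> \<sigma>] card_Diff_subset_Int[of \<sigma> \<tau>]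
    by (simp add: Int_commute)
  then obtain g where g: "g ` (\<tau> - \<sigma>) \<subseteq> \<sigma> - \<tau>" "inj_on g (\<tau> - \<sigma>)"
    using card_le_inj[of "\<tau> - \<sigma>" "\<sigma> - \<tau>"] fins by auto
  have "sum f (\<tau> - \<sigma>) \<le> (\<Sum>j\<in>\<tau> - \<sigma>. f (g j))"
    using g sub by (intro sum_mono top) auto
  also have "\<dots> = sum f (g ` (\<tau> - \<sigma>))"
    using g by (simp add: sum.reindex)
  also have "\<dots> \<le> sum f (\<sigma> - \<tau>)"
    using g fins nonneg by (intro sum_mono2) auto
  finally have "sum f (\<tau> - \<sigma>) + sum f (\<tau> \<inter> \<sigma>) \<le> sum f (\<sigma> - \<tau>) + sum f (\<sigma> \<inter> \<tau>)"
    by (simp add: Int_commute)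
  then show ?thesis
    using fins sum.Int_Diff[of \<tau> f \<sigma>] sum.Int_Diff[of \<sigma> f \<tau>] by simp
qed

section \<open>Feasibility of an optimal selection\<close>

theorem theorem3p3:
  fixes N n p R k :: nat
    and J :: "nat \<Rightarrow> nat"
    and T :: "(nat \<Rightarrow> nat) \<Rightarrow> real"
    and c :: "nat \<Rightarrow> nat \<Rightarrow> nat"
    and X V E S0 :: "real mat"
    and U :: "real vec \<Rightarrow> real mat"
    and h :: real
    and s0 :: "real vec"
    and \<sigma> :: "nat set"
  assumes mode: "n \<in> {1..N}"
    and p: "p = (\<Prod>i\<in>{1..N} - {n}. J i)"
    and order: "fiber_order N J n c"
    and X: "X = unfolding_mat N J n c T"
    and R: "0 < R" "R \<le> J n"
    and k: "0 < k" "k \<le> p"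
    and U: "basis_choice X R U"
    and s0: "Q_optimal X k U h s0"
    and V: "pca_solution X R V"
    and E: "E = X - V * V\<^sup>T * X"
    and S0: "S0 = mat_diag p (\<lambda>j. s0 $ j)"
    and \<sigma>: "top_columns E k \<sigma>"
  shows "eta X U s0 \<le> (frob_norm (E * S0))\<^sup>2
       \<and> (frob_norm (E * S0))\<^sup>2 \<le> (\<Sum>i\<in>\<sigma>. (frob_norm (column E i))\<^sup>2)
       \<and> Q_feasible X k U ((frob_norm (E * S0))\<^sup>2) s0"
proof -
  have dimX: "dim_row X = J n" "dim_col X = p"
    by (simp_all add: X p unfolding_mat_def)
  have feas: "Q_feasible X k U h s0"
    using s0 by (simp add: Q_optimal_def is_arg_max_def)
  then have bin: "s0 \<in> binary_vecs p"
    and ones: "vec p (\<lambda>_. 1) \<bullet> s0 \<le> real k"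
    by (simp_all add: Q_feasible_def dimX)
  have Vfr: "V \<in> orthonormal_frames (dim_row X) R"
    using V by (simp add: pca_solution_def is_arg_min_def)
  then have Vc: "V \<in> carrier_mat (J n) R"
    by (simp add: orthonormal_frames_def dimX)
  have Eres: "E = projection_residual V X"
    by (simp add: E projection_residual_def)
  have Ec: "E \<in> carrier_mat (J n) p"
    using Vc by (auto simp: E dimX)
  define e where "e j = (frob_norm (column E j))\<^sup>2" for j
  define \<tau> where "\<tau> = {j. j < p \<and> s0 $ j = 1}"
  have \<tau>: "\<tau> \<subseteq> {..<p}" "finite \<tau>" by (auto simp: \<tau>_def)
  have s0_\<tau>: "s0 $ j = (if j \<in> \<tau> then 1 else 0)" if "j < p" for j
    using bin that by (auto simp: binary_vecs_def \<tau>_def)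
  have ES0: "(frob_norm (E * S0))\<^sup>2 = sum e \<tau>"
    unfolding S0 e_def \<tau>_def by (rule frob_norm_sq_mult_diag[OF Ec bin])
  have bound: "eta X U s \<le> (\<Sum>j | j < p \<and> s $ j = 1. e j)" if "s \<in> binary_vecs p" for s
    using eta_le_sum_residual_columns[OF U _ Vfr, of s] that by (simp add: dimX e_def Eres)

  have "eta X U s0 \<le> (frob_norm (E * S0))\<^sup>2"
    using bound[OF bin] by (simp add: ES0 \<tau>_def)
  moreover have "(frob_norm (E * S0))\<^sup>2 \<le> (\<Sum>i\<in>\<sigma>. (frob_norm (column E i))\<^sup>2)"
  proof -
    have "vec p (\<lambda>_. 1) \<bullet> s0 = (\<Sum>j<p. s0 $ j)"
      using bin by (auto simp: scalar_prod_def binary_vecs_def lessThan_atLeast0)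
    also have "\<dots> = (\<Sum>j<p. if j \<in> \<tau> then 1 else 0)"
      by (simp add: s0_\<tau>)
    also have "\<dots> = real (card \<tau>)"
      using \<tau> by (simp add: sum.If_cases Int_absorb1)
    finally have "card \<tau> \<le> k" using ones by simp
    moreover have "\<sigma> \<subseteq> {..<p}" "card \<sigma> = k"
      "\<And>i j. i \<in> \<sigma> \<Longrightarrow> j \<in> {..<p} - \<sigma> \<Longrightarrow> e j \<le> e i"
      using \<sigma> Ec by (auto simp: top_columns_def e_def intro!: power_mono frob_norm_nonneg)
    ultimately have "sum e \<tau> \<le> sum e \<sigma>"
      using \<tau> by (intro sum_le_sum_top_set[of "{..<p}"]) (auto simp: e_def)
    then show ?thesis by (simp add: ES0 e_def)
  qed
  moreover have "Q_feasible X k U ((frob_norm (E * S0))\<^sup>2) s0"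
  proof -
    have "(\<Sum>j\<in>\<rho>. s0 $ j) \<le> real (card \<rho>) - 1"
      if \<rho>: "\<rho> \<subseteq> {..<p}" and gt: "eta X U (indicator_vec p \<rho>) > (frob_norm (E * S0))\<^sup>2" for \<rho>
    proof -
      have fin\<rho>: "finite \<rho>" using \<rho> finite_subset by blast
      have "indicator_vec p \<rho> \<in> binary_vecs p"
        by (simp add: indicator_vec_def binary_vecs_def)
      moreover have "{j. j < p \<and> indicator_vec p \<rho> $ j = 1} = \<rho>"
        using \<rho> by (auto simp: indicator_vec_def split: if_splits)
      ultimately have "eta X U (indicator_vec p \<rho>) \<le> sum e \<rho>"
        using bound[of "indicator_vec p \<rho>"] by simp
      then have "\<not> \<rho> \<subseteq> \<tau>"
        using gt sum_mono2[of \<tau> \<rho> e] \<tau> by (auto simp: ES0 e_def)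
      then have "card (\<rho> \<inter> \<tau>) < card \<rho>"
        using fin\<rho> by (intro psubset_card_mono) auto
      moreover have "(\<Sum>j\<in>\<rho>. s0 $ j) = (\<Sum>j\<in>\<rho>. if j \<in> \<tau> then 1 else 0)"
        using \<rho> by (intro sum.cong refl s0_\<tau>) auto
      moreover have "\<dots> = real (card (\<rho> \<inter> \<tau>))"
        using fin\<rho> by (simp add: sum.If_cases)
      ultimately show ?thesis by simp
    qed
    then show ?thesis
      using bin ones by (simp add: Q_feasible_def dimX)
  qed
  ultimately show ?thesis by blast
qed

end
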